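(* Let $K$ be a field of characteristic $\neq 2$, let $E$ be a finite-dimensional $K$-vector space with an anisotropic symmetric bilinear form $(X,Y)\mapsto X.Y$, and let $F$ be the space of cycles of $E$ with the cycle pairing $\langle\cdot,\cdot\rangle$. Let $p$ be a non-isotropic cycle in $F$, let $\mathcal{R}$ be the hyperplane reflection $\mathcal{R}(q)=q-2\frac{\langle q,p\rangle}{\langle p,p\rangle}p$ of $F$, and let $V$ be the set of isotropic points of the projective space $\hat F$, identified with $E\cup\{\infty\}$. Then: (a) If $p$ is a 1-cycle $b.X+c$ (with $b\neq 0$), then the action of $\mathcal{R}$ on $V=E\cup\{\infty\}$ is the same as the affine reflection defined by $p$. (b) If $p$ is a non-isotropic 2-cycle $(X-b).(X-b)-s$ with $s\neq 0$, then the action of $\mathcal{R}$ on $V=E\cup\{\infty\}$ is the same as the inversion with respect to the 2-cycle $p$.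
   Context: Anisotropic means $X.X=0$ only for $X=0$. A cycle is an expression (function on $E$) $p(X)=aX.X+b.X+c$ with $a,c\in K$ and $b\in E$, determined by its parameters $(a,b,c)$; the cycles form a $K$-vector space $F$ of dimension $\dim E+2$. It is a 2-cycle if $a\neq 0$, a 1-cycle if $a=0$ and $b\neq 0$, and a 0-cycle if it is a constant. The cycle pairing is the symmetric bilinear form $\langle p,p^*\rangle=b.b^*-2ac^*-2a^*c$ for $p=aX.X+b.X+c$, $p^*=a^*X.X+b^*.X+c^*$. A cycle $p$ is isotropic if $\langle p,p\rangle=0$, non-isotropic otherwise. $\hat F$ is the projective space of lines in $F$, and $V\subset\hat F$ is the set of classes of nonzero isotropic cycles. $V$ is identified with $E\cup\{\infty\}$: the class of nonzero constants corresponds to $\infty$, and the class of $(X-m).(X-m)=X.X-2m.X+m.m$ corresponds to the point $m\in E$. The reflection $\mathcal{R}$ preserves the pairing, hence induces a map of $V$ to itself. Affine reflection defined by a 1-cycle $L(x)=b.x+c$ ($b\ne0$): the map of $E\cup\{\infty\}$ sending $\infty$ to $\infty$ and $x\in E$ to $x-2\frac{L(x)}{b.b}\,b$. Inversion with respect to a 2-cycle $a(X-b).(X-b)-as$ with $a,s\neq 0$: the map of $E\cup\{\infty\}$ interchanging $b$ and $\infty$ and sending each $x\in E$, $x\neq b$, to the point $x'$ collinear with $b$ and $x$ such that $(x-b).(x'-b)=s$, i.e. $x'-b=\frac{s}{(x-b).(x-b)}(x-b)$. *)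

theory Defs
  imports Complex_Main "HOL-Library.Product_Plus"
begin

locale anisotropic_space = vector_space scale
  for scale :: "'k::field \<Rightarrow> 'e::ab_group_add \<Rightarrow> 'e" +
  fixes dot :: "'e \<Rightarrow> 'e \<Rightarrow> 'k"
  assumes finite_dim: "\<exists>B. finite_dimensional_vector_space scale B"
    and dot_linear: "\<And>y. Vector_Spaces.linear scale (*) (\<lambda>x. dot x y)"
    and dot_commute: "\<And>x y. dot x y = dot y x"
    and anisotropic: "\<And>x. dot x x = 0 \<Longrightarrow> x = 0"

text \<open>
  The triple \<open>(a, b, c)\<close> stands for the expression \<open>a X.X + b.X + c\<close>. Cycles are formal
  expressions: in the degenerate case \<open>E = 0\<close> distinct triples induce the same function,
  but the space of cycles still has dimension \<open>dim E + 2\<close>.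
\<close>

type_synonym ('k, 'e) cycle = "'k \<times> 'e \<times> 'k"

fun cycle_eval :: "('e \<Rightarrow> 'e \<Rightarrow> 'k::field) \<Rightarrow> ('k, 'e) cycle \<Rightarrow> 'e \<Rightarrow> 'k" where
  "cycle_eval dot (a, b, c) x = a * dot x x + dot b x + c"

fun cycle_scale :: "('k::field \<Rightarrow> 'e \<Rightarrow> 'e) \<Rightarrow> 'k \<Rightarrow> ('k, 'e) cycle \<Rightarrow> ('k, 'e) cycle" where
  "cycle_scale scale k (a, b, c) = (k * a, scale k b, k * c)"

fun cycle_pairing :: "('e \<Rightarrow> 'e \<Rightarrow> 'k::field) \<Rightarrow> ('k, 'e) cycle \<Rightarrow> ('k, 'e) cycle \<Rightarrow> 'k" where
  "cycle_pairing dot (a, b, c) (a', b', c') = dot b b' - 2 * a * c' - 2 * a' * c"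

definition isotropic_cycle :: "('e \<Rightarrow> 'e \<Rightarrow> 'k::field) \<Rightarrow> ('k, 'e) cycle \<Rightarrow> bool" where
  "isotropic_cycle dot p \<longleftrightarrow> cycle_pairing dot p p = 0"

definition cycle_reflection ::
  "('k::field \<Rightarrow> 'e::ab_group_add \<Rightarrow> 'e) \<Rightarrow> ('e \<Rightarrow> 'e \<Rightarrow> 'k) \<Rightarrow>
   ('k, 'e) cycle \<Rightarrow> ('k, 'e) cycle \<Rightarrow> ('k, 'e) cycle" where
  "cycle_reflection scale dot p q =
     q - cycle_scale scale (2 * (cycle_pairing dot q p / cycle_pairing dot p p)) p"

definition cycle_class ::
  "('k::field \<Rightarrow> 'e::ab_group_add \<Rightarrow> 'e) \<Rightarrow> ('k, 'e) cycle \<Rightarrow> ('k, 'e) cycle set" where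
  "cycle_class scale q = module.span (cycle_scale scale) {q}"

definition isotropic_points ::
  "('k::field \<Rightarrow> 'e::ab_group_add \<Rightarrow> 'e) \<Rightarrow> ('e \<Rightarrow> 'e \<Rightarrow> 'k) \<Rightarrow> ('k, 'e) cycle set set" where
  "isotropic_points scale dot = {cycle_class scale q | q. q \<noteq> 0 \<and> isotropic_cycle dot q}"

text \<open>
  The cycle \<open>a (X - b).(X - b) - a s\<close>.
\<close>

definition two_cycle ::
  "('k::field \<Rightarrow> 'e::ab_group_add \<Rightarrow> 'e) \<Rightarrow> ('e \<Rightarrow> 'e \<Rightarrow> 'k) \<Rightarrow> 'k \<Rightarrow> 'e \<Rightarrow> 'k \<Rightarrow> ('k, 'e) cycle" where
  "two_cycle scale dot a b s = (a, scale (- (2 * a)) b, a * dot b b - a * s)"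

text \<open>
  The set \<open>E \<union> {\<infinity>}\<close> is \<^typ>\<open>'e option\<close>, with \<^term>\<open>None\<close> for \<open>\<infinity>\<close>.
\<close>

fun point_class ::
  "('k::field \<Rightarrow> 'e::ab_group_add \<Rightarrow> 'e) \<Rightarrow> ('e \<Rightarrow> 'e \<Rightarrow> 'k) \<Rightarrow> 'e option \<Rightarrow> ('k, 'e) cycle set" where
  "point_class scale dot None = cycle_class scale (0, 0, 1)"
| "point_class scale dot (Some m) = cycle_class scale (two_cycle scale dot 1 m 0)"

text \<open>
  The identification of \<open>V\<close> with \<open>E \<union> {\<infinity>}\<close>; that \<^const>\<open>point_class\<close> is a bijection onto \<open>V\<close>
  is proved in \<open>bij_betw_point_class\<close> below.
\<close>

definition point_of_class ::
  "('k::field \<Rightarrow> 'e::ab_group_add \<Rightarrow> 'e) \<Rightarrow> ('e \<Rightarrow> 'e \<Rightarrow> 'k) \<Rightarrow> ('k, 'e) cycle set \<Rightarrow> 'e option" where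
  "point_of_class scale dot = the_inv_into UNIV (point_class scale dot)"

fun affine_reflection ::
  "('k::field \<Rightarrow> 'e::ab_group_add \<Rightarrow> 'e) \<Rightarrow> ('e \<Rightarrow> 'e \<Rightarrow> 'k) \<Rightarrow> 'e \<Rightarrow> 'k \<Rightarrow> 'e option \<Rightarrow> 'e option" where
  "affine_reflection scale dot b c None = None"
| "affine_reflection scale dot b c (Some x) =
     Some (x - scale (2 * (cycle_eval dot (0, b, c) x / dot b b)) b)"

text \<open>
  The inversion with respect to \<open>a (X - b).(X - b) - a s\<close>, which does not depend on \<open>a\<close>.
  The formula for \<open>x \<noteq> b\<close> is characterised geometrically in \<open>inversion_point_iff\<close> below.
\<close>

fun inversion ::
  "('k::field \<Rightarrow> 'e::ab_group_add \<Rightarrow> 'e) \<Rightarrow> ('e \<Rightarrow> 'e \<Rightarrow> 'k) \<Rightarrow> 'e \<Rightarrow> 'k \<Rightarrow> 'e option \<Rightarrow> 'e option" where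
  "inversion scale dot b s None = Some b"
| "inversion scale dot b s (Some x) =
     (if x = b then None else Some (b + scale (s / dot (x - b) (x - b)) (x - b)))"

context anisotropic_space
begin

lemma dot_add_left: "dot (x + y) z = dot x z + dot y z"
  and dot_scale_left: "dot (scale k x) z = k * dot x z"
  using dot_linear[of z] by (simp_all add: Vector_Spaces.linear_iff)

lemma dot_add_right: "dot z (x + y) = dot z x + dot z y"
  and dot_scale_right: "dot z (scale k x) = k * dot z x"
  by (simp_all add: dot_commute[of z] dot_add_left dot_scale_left)

lemma dot_zero_left [simp]: "dot 0 x = 0"
  using dot_scale_left[of 0 0 x] by simp

lemma dot_zero_right [simp]: "dot x 0 = 0"
  by (simp add: dot_commute[of x])

lemma dot_minus_left: "dot (- x) y = - dot x y"
  using dot_add_left[of x "- x" y] by (simp add: eq_neg_iff_add_eq_0 add.commute)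

lemma dot_minus_right: "dot x (- y) = - dot x y"
  by (simp add: dot_commute[of x] dot_minus_left)

lemma dot_diff_left: "dot (x - y) z = dot x z - dot y z"
  using dot_add_left[of x "- y" z] by (simp add: dot_minus_left)

lemma dot_diff_right: "dot z (x - y) = dot z x - dot z y"
  by (simp add: dot_commute[of z] dot_diff_left)

lemmas dot_simps = dot_add_left dot_add_right dot_scale_left dot_scale_right
  dot_minus_left dot_minus_right dot_diff_left dot_diff_right

lemma dot_self_eq_0_iff: "dot x x = 0 \<longleftrightarrow> x = 0"
  using anisotropic by auto

lemma vector_space_cycle: "vector_space (cycle_scale scale)"
  by unfold_locales
    (auto simp: algebra_simps scale_right_distrib scale_left_distrib)

lemma cycle_class_eq: "cycle_class scale q = range (\<lambda>k. cycle_scale scale k q)"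
proof -
  interpret C: vector_space "cycle_scale scale" by (rule vector_space_cycle)
  show ?thesis by (simp add: cycle_class_def C.span_singleton)
qed

lemma cycle_class_scale:
  assumes "k \<noteq> 0"
  shows "cycle_class scale (cycle_scale scale k q) = cycle_class scale q"
proof -
  interpret C: vector_space "cycle_scale scale" by (rule vector_space_cycle)
  have sub: "cycle_scale scale j q \<in> cycle_class scale (cycle_scale scale k q)" for j
  proof -
    have "cycle_scale scale j q = cycle_scale scale (j / k) (cycle_scale scale k q)"
      using assms by (simp only: C.scale_scale) simp
    then show ?thesis unfolding cycle_class_eq by (rule range_eqI)
  qed
  have "cycle_scale scale j (cycle_scale scale k q) \<in> cycle_class scale q" for j
    unfolding cycle_class_eq by (rule range_eqI) (rule C.scale_scale)
  then show ?thesis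
    using sub by (metis cycle_class_eq image_subsetI subset_antisym)
qed

lemma cycle_class_eqD:
  assumes "cycle_class scale p = cycle_class scale q"
  obtains k where "p = cycle_scale scale k q"
proof -
  interpret C: vector_space "cycle_scale scale" by (rule vector_space_cycle)
  have "p \<in> cycle_class scale p"
    unfolding cycle_class_eq using C.scale_one[of p] by (metis rangeI)
  then show ?thesis using assms that unfolding cycle_class_eq by auto
qed

lemma cycle_eval_two_cycle:
  "cycle_eval dot (two_cycle scale dot a b s) x = a * dot (x - b) (x - b) - a * s"
  by (simp add: two_cycle_def dot_simps dot_commute[of x b] algebra_simps)

lemma cycle_pairing_two_cycle:
  "cycle_pairing dot (two_cycle scale dot a b s) (two_cycle scale dot a b s) = 4 * a\<^sup>2 * s"
  by (simp add: two_cycle_def dot_simps power2_eq_square algebra_simps)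

lemma two_neq_0:
  assumes "CHAR('k) \<noteq> 2"
  shows "(2 :: 'k) \<noteq> 0"
proof
  assume "(2 :: 'k) = 0"
  then have "CHAR('k) dvd 2"
    by (metis of_nat_eq_0_iff_char_dvd of_nat_numeral)
  then have "CHAR('k) = 1 \<or> CHAR('k) = 2"
    using dvd_imp_le[of "CHAR('k)" 2] by (cases "CHAR('k)" rule: nat.exhaust) (auto simp: le_Suc_eq numeral_2_eq_2)
  then show False using assms CHAR_not_1 [where 'a = 'k] by auto
qed

lemma bij_betw_point_class:
  assumes "CHAR('k) \<noteq> 2"
  shows "bij_betw (point_class scale dot) UNIV (isotropic_points scale dot)"
proof -
  note two = two_neq_0[OF assms]
  have "inj (point_class scale dot)"
  proof (rule injI)
    fix x y assume "point_class scale dot x = point_class scale dot y"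
    then show "x = y"
      using two
      by (cases x; cases y)
        (auto simp: two_cycle_def elim!: cycle_class_eqD)
  qed
  moreover have "range (point_class scale dot) = isotropic_points scale dot"
  proof (intro equalityI subsetI)
    fix P assume "P \<in> range (point_class scale dot)"
    then obtain x where P: "P = point_class scale dot x" by auto
    show "P \<in> isotropic_points scale dot"
    proof (cases x)
      case None
      have "((0, 0, 1) :: ('k, 'e) cycle) \<noteq> 0 \<and> isotropic_cycle dot (0, 0, 1)"
        by (simp add: isotropic_cycle_def zero_prod_def)
      then show ?thesis using P None by (auto simp: isotropic_points_def)
    next
      case (Some m)
      have "two_cycle scale dot 1 m 0 \<noteq> 0 \<and> isotropic_cycle dot (two_cycle scale dot 1 m 0)"
        by (simp add: isotropic_cycle_def cycle_pairing_two_cycle)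
          (simp add: two_cycle_def zero_prod_def)
      then show ?thesis using P Some unfolding isotropic_points_def by fastforce
    qed
  next
    fix P assume "P \<in> isotropic_points scale dot"
    then obtain a b c where P: "P = cycle_class scale (a, b, c)"
      and nz: "(a, b, c) \<noteq> 0" and iso: "cycle_pairing dot (a, b, c) (a, b, c) = 0"
      by (auto simp: isotropic_points_def isotropic_cycle_def)
    show "P \<in> range (point_class scale dot)"
    proof (cases "a = 0")
      case True
      then have "b = 0" using iso anisotropic by simp
      then have "c \<noteq> 0" using nz True by (simp add: zero_prod_def)
      then have "P = cycle_class scale (0, 0, 1)"
        using P True \<open>b = 0\<close> cycle_class_scale[of c "(0, 0, 1)"] by simp
      then show ?thesis by (metis point_class.simps(1) rangeI)
    next
      case False
      define m where "m = scale (- (1 / (2 * a))) b"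
      have "dot b b = 4 * a * c" using iso by (simp add: algebra_simps)
      moreover have "(4 :: 'k) \<noteq> 0"
        using two by (metis mult_2 mult_eq_0_iff numeral_Bit0)
      ultimately have "a * dot m m = c"
        using False two by (simp add: m_def dot_simps field_simps)
      moreover have "scale (- (2 * a)) m = b"
        using False two by (simp add: m_def)
      ultimately have "cycle_scale scale a (two_cycle scale dot 1 m 0) = (a, b, c)"
        by (simp add: two_cycle_def mult.commute)
      then have "P = cycle_class scale (two_cycle scale dot 1 m 0)"
        using P False cycle_class_scale by metis
      then show ?thesis by (metis point_class.simps(2) rangeI)
    qed
  qed
  ultimately show ?thesis by (simp add: bij_betw_def)
qed

lemma inversion_point_iff:
  assumes "x \<noteq> b"
  shows "(\<exists>t. x' - b = scale t (x - b)) \<and> dot (x - b) (x' - b) = s \<longleftrightarrow>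
    inversion scale dot b s (Some x) = Some x'"
proof -
  have nz: "dot (x - b) (x - b) \<noteq> 0" using assms by (simp add: dot_self_eq_0_iff)
  show ?thesis
  proof
    assume "(\<exists>t. x' - b = scale t (x - b)) \<and> dot (x - b) (x' - b) = s"
    then obtain t where t: "x' - b = scale t (x - b)" and "dot (x - b) (x' - b) = s" by blast
    then have "t = s / dot (x - b) (x - b)" using nz by (auto simp: dot_scale_right)
    then show "inversion scale dot b s (Some x) = Some x'"
      using t assms by (metis add.commute diff_add_cancel inversion.simps(2))
  next
    assume "inversion scale dot b s (Some x) = Some x'"
    then have "x' - b = scale (s / dot (x - b) (x - b)) (x - b)" using assms by auto
    then show "(\<exists>t. x' - b = scale t (x - b)) \<and> dot (x - b) (x' - b) = s"
      using nz by (metis dot_scale_right nonzero_eq_divide_eq)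
  qed
qed

end

end

theory Submission
  imports Defs
begin

text \<open>
  The reflection \<open>\<R>\<close> is linear, so it sends the line spanned by a cycle \<open>q\<close> to the line spanned by
  \<open>\<R> q\<close>. Its action on \<open>V\<close> is therefore determined by the images of the representatives
  \<open>(0, 0, 1)\<close> of \<open>\<infinity>\<close> and \<open>(X - m).(X - m)\<close> of \<open>m\<close>, and it suffices to check that \<open>\<R>\<close> maps the
  representative of each point to a nonzero multiple of the representative of the expected image.

  For a 1-cycle the multiple is always \<open>1\<close>. For the 2-cycle \<open>(X - b).(X - b) - s\<close>, whose pairing with
  itself is \<open>4 s\<close>, the multiple is \<open>1 / s\<close> for \<open>\<infinity>\<close>, \<open>s\<close> for \<open>b\<close>, and \<open>(m - b).(m - b) / s\<close> for any other
  \<open>m\<close>; the last is nonzero because the form is anisotropic.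
\<close>

context anisotropic_space
begin

lemma cycle_reflection_scale:
  "cycle_reflection scale dot p (cycle_scale scale k q) =
     cycle_scale scale k (cycle_reflection scale dot p q)"
proof -
  interpret C: vector_space "cycle_scale scale" by (rule vector_space_cycle)
  have "cycle_pairing dot (cycle_scale scale k q) p = k * cycle_pairing dot q p"
    by (cases p; cases q) (simp add: dot_simps algebra_simps)
  then show ?thesis
    by (simp add: cycle_reflection_def C.scale_right_diff_distrib mult.left_commute)
qed

lemma cycle_reflection_image_class:
  "cycle_reflection scale dot p ` cycle_class scale q =
     cycle_class scale (cycle_reflection scale dot p q)"
  by (simp add: cycle_class_eq image_image cycle_reflection_scale)

lemma cycle_reflection_image_classI:
  assumes "cycle_reflection scale dot p q = cycle_scale scale k q'" and "k \<noteq> 0"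
  shows "cycle_reflection scale dot p ` cycle_class scale q = cycle_class scale q'"
  using assms by (simp add: cycle_reflection_image_class cycle_class_scale)

text \<open>
  The passage from \<open>E \<union> {\<infinity>}\<close> to \<open>V\<close>: since \<^const>\<open>point_class\<close> is a bijection with inverse
  \<^const>\<open>point_of_class\<close>, the action of a map of cycles on \<open>V\<close> can be read off from its effect on
  the classes of points.
\<close>

lemma action_on_isotropic_points:
  assumes "CHAR('k) \<noteq> 2"
    and action: "\<And>x. f ` point_class scale dot x = point_class scale dot (g x)"
    and P: "P \<in> isotropic_points scale dot"
  shows "f ` P \<in> isotropic_points scale dot \<and>
    point_of_class scale dot (f ` P) = g (point_of_class scale dot P)"
proof -
  have bij: "bij_betw (point_class scale dot) UNIV (isotropic_points scale dot)"
    using assms(1) by (rule bij_betw_point_class)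
  have inverse: "point_of_class scale dot (point_class scale dot x) = x" for x
    using bij unfolding point_of_class_def by (simp add: bij_betw_def the_inv_into_f_f)
  obtain x where "P = point_class scale dot x"
    using bij P by (auto simp: bij_betw_def)
  then show ?thesis
    using bij by (auto simp: action inverse bij_betw_def)
qed

lemma reflection_one_cycle_point:
  assumes "b \<noteq> 0"
  shows "cycle_reflection scale dot (0, b, c) ` point_class scale dot x =
    point_class scale dot (affine_reflection scale dot b c x)"
proof (cases x)
  case None
  have "cycle_reflection scale dot (0, b, c) (0, 0, 1) = (0, 0, 1)"
    by (simp add: cycle_reflection_def)
  then show ?thesis
    using None by (simp add: cycle_reflection_image_class)
next
  case (Some m)
  have nz: "dot b b \<noteq> 0" using assms by (simp add: dot_self_eq_0_iff)
  \<comment> \<open>The affine reflection sends \<open>m\<close> to \<open>m - 2 t b\<close>. Eliminating \<open>c\<close> in favour of \<open>t\<close> makes the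
    comparison of cycles free of division.\<close>
  define t where "t = (dot b m + c) / dot b b"
  have c: "c = t * dot b b - dot b m" using nz by (simp add: t_def)
  have coeff: "cycle_pairing dot (two_cycle scale dot 1 m 0) (0, b, c) / dot b b = - 2 * t"
    using nz by (simp add: two_cycle_def dot_simps dot_commute[of m b] t_def field_simps)
  have "cycle_reflection scale dot (0, b, c) (two_cycle scale dot 1 m 0) =
      two_cycle scale dot 1 (m - scale (2 * t) b) 0"
    using coeff
    by (simp add: cycle_reflection_def)
      (simp add: two_cycle_def dot_simps dot_commute[of m b] c scale_right_diff_distrib algebra_simps)
  then show ?thesis
    using Some by (simp add: cycle_reflection_image_class t_def)
qed

lemma reflection_two_cycle_point:
  assumes two: "(2 :: 'k) \<noteq> 0" and s: "s \<noteq> 0"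
  shows "cycle_reflection scale dot (two_cycle scale dot 1 b s) ` point_class scale dot x =
    point_class scale dot (inversion scale dot b s x)"
proof -
  let ?p = "two_cycle scale dot 1 b s"
  have four: "(4 :: 'k) \<noteq> 0"
    using two by (metis mult_2 mult_eq_0_iff numeral_Bit0)
  have square: "cycle_pairing dot ?p ?p = 4 * s"
    by (simp add: cycle_pairing_two_cycle)
  show ?thesis
  proof (cases x)
    case None
    have "2 * (cycle_pairing dot (0, 0, 1) ?p / cycle_pairing dot ?p ?p) = - (1 / s)"
      unfolding square using s two four by (simp add: two_cycle_def field_simps)
    then have "cycle_reflection scale dot ?p (0, 0, 1) =
        cycle_scale scale (1 / s) (two_cycle scale dot 1 b 0)"
      using s by (simp add: cycle_reflection_def) (simp add: two_cycle_def field_simps)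
    then show ?thesis
      using None s by (simp add: cycle_reflection_image_classI)
  next
    case (Some m)
    \<comment> \<open>In coordinates centred at \<open>b\<close> the inversion is \<open>v \<mapsto> (s / d) v\<close> with \<open>d = v.v\<close>.\<close>
    define v where "v = m - b"
    define d where "d = dot v v"
    have m: "m = b + v" by (simp add: v_def)
    have pairing: "cycle_pairing dot (two_cycle scale dot 1 m 0) ?p = 2 * (s - d)"
      by (simp add: two_cycle_def m d_def dot_simps dot_commute[of v b] algebra_simps)
    have "2 * (cycle_pairing dot (two_cycle scale dot 1 m 0) ?p / cycle_pairing dot ?p ?p) =
        1 - d / s"
      unfolding pairing square using s two four by (simp add: field_simps)
    then have reflection: "cycle_reflection scale dot ?p (two_cycle scale dot 1 m 0) =
        two_cycle scale dot 1 m 0 - cycle_scale scale (1 - d / s) ?p"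
      by (simp add: cycle_reflection_def)
    show ?thesis
    proof (cases "m = b")
      case True
      have "cycle_reflection scale dot ?p (two_cycle scale dot 1 m 0) =
          cycle_scale scale s (0, 0, 1)"
        unfolding reflection using True by (simp add: two_cycle_def v_def d_def)
      then show ?thesis
        using Some True s by (simp add: cycle_reflection_image_classI)
    next
      case False
      then have d: "d \<noteq> 0" by (simp add: d_def v_def dot_self_eq_0_iff)
      have "cycle_reflection scale dot ?p (two_cycle scale dot 1 m 0) =
          cycle_scale scale (d / s) (two_cycle scale dot 1 (b + scale (s / d) v) 0)"
        unfolding reflection using s d
        by (simp add: two_cycle_def m dot_simps dot_commute[of v b] scale_right_distrib
            scale_left_diff_distrib flip: d_def) (simp add: field_simps)
      then show ?thesis
        using Some False s d by (simp add: cycle_reflection_image_classI d_def v_def)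
    qed
  qed
qed

end

theorem theorem5p1:
  fixes scale :: "'k::field \<Rightarrow> 'e::ab_group_add \<Rightarrow> 'e"
    and dot :: "'e \<Rightarrow> 'e \<Rightarrow> 'k"
    and p :: "('k, 'e) cycle"
  assumes "anisotropic_space scale dot"
    and "CHAR('k) \<noteq> 2"
    and "\<not> isotropic_cycle dot p"
  shows "(\<forall>b c. b \<noteq> 0 \<and> p = (0, b, c) \<longrightarrow>
           (\<forall>P \<in> isotropic_points scale dot.
              cycle_reflection scale dot p ` P \<in> isotropic_points scale dot \<and>
              point_of_class scale dot (cycle_reflection scale dot p ` P) =
                affine_reflection scale dot b c (point_of_class scale dot P))) \<and>
         (\<forall>b s. s \<noteq> 0 \<and> p = two_cycle scale dot 1 b s \<longrightarrow>
           (\<forall>P \<in> isotropic_points scale dot.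
              cycle_reflection scale dot p ` P \<in> isotropic_points scale dot \<and>
              point_of_class scale dot (cycle_reflection scale dot p ` P) =
                inversion scale dot b s (point_of_class scale dot P)))"
proof -
  interpret anisotropic_space scale dot by fact
  have two: "(2 :: 'k) \<noteq> 0" using \<open>CHAR('k) \<noteq> 2\<close> by (rule two_neq_0)
  note action = action_on_isotropic_points[OF \<open>CHAR('k) \<noteq> 2\<close>]
  show ?thesis
    using action[OF reflection_one_cycle_point] action[OF reflection_two_cycle_point[OF two]]
    by blast
qed

end
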